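(* Let $ABC$ be a triangle with incenter $I$ and suppose $\angle ABC=60^\circ$. Let the cevians through $I$ be $AD$, $BE$, $CF$, with $D$ on side $BC$, $E$ on side $CA$, $F$ on side $AB$. Let $r_1$ be the radius of the excircle of $\triangle BID$ that touches side $BD$, $r_2$ the radius of the excircle of $\triangle CID$ that touches side $DC$, $r_3$ the radius of the excircle of $\triangle CIE$ that touches side $CE$, $r_4$ the radius of the excircle of $\triangle AIE$ that touches side $EA$, $r_5$ the radius of the excircle of $\triangle AIF$ that touches side $AF$, and $r_6$ the radius of the excircle of $\triangle BIF$ that touches side $FB$. Then $$\frac{1}{r_1}+\frac{1}{r_4}+\frac{1}{r_5}=\frac{1}{r_2}+\frac{1}{r_3}+\frac{1}{r_6}.$$
   Context: A cevian through a point $P$ inside a triangle is the segment from a vertex through $P$ to the opposite side. The excircle of a triangle that touches a given side is the circle tangent to that side (segment) and to the extensions of the other two sides, lying on the opposite side of that segment from the remaining vertex. *)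

theory Defs
  imports "HOL-Analysis.Analysis"
begin

definition angle :: "real ^ 2 \<Rightarrow> real ^ 2 \<Rightarrow> real ^ 2 \<Rightarrow> real" where
  "angle A B C = arccos (((A - B) \<bullet> (C - B)) / (norm (A - B) * norm (C - B)))"

text \<open>The circle with centre \<open>J\<close> and radius \<open>r\<close> touches the line through \<open>P\<close> and \<open>Q\<close> at \<open>T\<close>.
  Positivity of \<open>r\<close> excludes the degenerate circle \<open>{J}\<close>.\<close>

definition tangent_at :: "real ^ 2 \<Rightarrow> real \<Rightarrow> real ^ 2 \<Rightarrow> real ^ 2 \<Rightarrow> real ^ 2 \<Rightarrow> bool" where
  "tangent_at J r P Q T \<longleftrightarrow> r > 0 \<and> sphere J r \<inter> affine hull {P, Q} = {T}"

text \<open>The points of contact lie on the sides themselves, not on their extensions; this is what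
  distinguishes the incircle from the three excircles.\<close>

definition is_incircle ::
    "real ^ 2 \<Rightarrow> real \<Rightarrow> real ^ 2 \<Rightarrow> real ^ 2 \<Rightarrow> real ^ 2 \<Rightarrow> bool" where
  "is_incircle J r A B C \<longleftrightarrow>
     (\<exists>T \<in> closed_segment B C. tangent_at J r B C T) \<and>
     (\<exists>T \<in> closed_segment C A. tangent_at J r C A T) \<and>
     (\<exists>T \<in> closed_segment A B. tangent_at J r A B T)"

definition is_incenter :: "real ^ 2 \<Rightarrow> real ^ 2 \<Rightarrow> real ^ 2 \<Rightarrow> real ^ 2 \<Rightarrow> bool" where
  "is_incenter J A B C \<longleftrightarrow> (\<exists>r. is_incircle J r A B C)"

text \<open>\<open>VX\<close> is the cevian through \<open>Z\<close> from the vertex \<open>V\<close> to the opposite side \<open>PQ\<close>.\<close>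

definition is_cevian ::
    "real ^ 2 \<Rightarrow> real ^ 2 \<Rightarrow> real ^ 2 \<Rightarrow> real ^ 2 \<Rightarrow> real ^ 2 \<Rightarrow> bool" where
  "is_cevian V P Q Z X \<longleftrightarrow> X \<in> closed_segment P Q \<and> Z \<in> closed_segment V X"

text \<open>The excircle of triangle \<open>VPQ\<close> touching the side \<open>PQ\<close>. The three existential clauses say that
  it touches the segment \<open>PQ\<close>, the extension of \<open>VP\<close> beyond \<open>P\<close>, and the extension of \<open>VQ\<close>
  beyond \<open>Q\<close>; the last clause says that it lies on the side of the line \<open>PQ\<close> opposite to \<open>V\<close>.\<close>

definition is_excircle ::
    "real ^ 2 \<Rightarrow> real \<Rightarrow> real ^ 2 \<Rightarrow> real ^ 2 \<Rightarrow> real ^ 2 \<Rightarrow> bool" where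
  "is_excircle J r V P Q \<longleftrightarrow>
     (\<exists>T \<in> closed_segment P Q. tangent_at J r P Q T) \<and>
     (\<exists>T. P \<in> closed_segment V T \<and> tangent_at J r V P T) \<and>
     (\<exists>T. Q \<in> closed_segment V T \<and> tangent_at J r V Q T) \<and>
     (\<forall>X \<in> sphere J r. closed_segment V X \<inter> affine hull {P, Q} \<noteq> {})"

definition is_exradius :: "real \<Rightarrow> real ^ 2 \<Rightarrow> real ^ 2 \<Rightarrow> real ^ 2 \<Rightarrow> bool" where
  "is_exradius r V P Q \<longleftrightarrow> (\<exists>J. is_excircle J r V P Q)"

end

theory Submission
  imports Defs
begin

text \<open>Write \<open>a\<close>, \<open>b\<close>, \<open>c\<close> for the sides of \<open>ABC\<close>, \<open>\<rho>\<close> for its inradius, and \<open>x\<close>, \<open>y\<close>, \<open>z\<close> for the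
  distances of \<open>I\<close> from \<open>A\<close>, \<open>B\<close>, \<open>C\<close>. The exradius of a triangle \<open>VPQ\<close> at \<open>PQ\<close> is twice the area
  divided by \<open>VP + VQ - PQ\<close>, and the six triangles with apex \<open>I\<close> have common height \<open>\<rho>\<close>. With the
  bisector formulas \<open>BD = ac/(b+c)\<close> and \<open>ID = ax/(b+c)\<close> this gives
  \<open>\<rho>/r\<^sub>1 = ((b+c)y + ax)/(ac) - 1\<close>, and similarly for the others. After clearing denominators the
  terms in \<open>y\<close> cancel and the claim becomes \<open>a(a+b)x = c(b+c)z\<close>. Squaring and using
  \<open>x\<^sup>2 = bc(b+c-a)/(a+b+c)\<close>, \<open>z\<^sup>2 = ab(a+b-c)/(a+b+c)\<close>, this follows from
  \<open>b\<^sup>2 = a\<^sup>2 + c\<^sup>2 - ac\<close>, which yields \<open>(a+b)(b+c-a) = c(b+c)\<close> and \<open>(b+c)(a+b-c) = a(a+b)\<close>.\<close>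

section \<open>Determinants, areas and linear independence in the plane\<close>

text \<open>For edge vectors from a common vertex this is twice the signed area, so nonvanishing
  serves as nondegeneracy.\<close>

definition cross2 :: "real ^ 2 \<Rightarrow> real ^ 2 \<Rightarrow> real" where
  "cross2 u v = u $ 1 * v $ 2 - u $ 2 * v $ 1"

lemma inner_2: "(u :: real ^ 2) \<bullet> v = u $ 1 * v $ 1 + u $ 2 * v $ 2"
  by (simp add: inner_vec_def sum_2)

lemma cross2_power2: "(cross2 u v)\<^sup>2 = (norm u)\<^sup>2 * (norm v)\<^sup>2 - (u \<bullet> v)\<^sup>2"
  unfolding power2_norm_eq_inner cross2_def inner_2 by algebra

text \<open>The vector on the right is \<open>w\<close> turned by a right angle and scaled by
  \<open>cross2 u v\<close> up to sign. Hence the length of \<open>w\<close> can be recovered from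
  its inner products with \<open>u\<close> and \<open>v\<close>.\<close>

lemma cross2_power2_norm:
  "(cross2 u v)\<^sup>2 * (norm w)\<^sup>2 = (norm ((w \<bullet> u) *\<^sub>R v - (w \<bullet> v) *\<^sub>R u))\<^sup>2"
  unfolding power2_norm_eq_inner cross2_def inner_2
    vector_minus_component vector_scaleR_component real_scaleR_def by algebra

lemma cross2_zero_eqI:
  assumes "cross2 u v \<noteq> 0" "w \<bullet> u = w' \<bullet> u" "w \<bullet> v = w' \<bullet> v"
  shows "w = w'"
  using cross2_power2_norm[of u v "w - w'"] assms by (simp add: inner_diff_left)

lemma cross2_scaleR_eq:
  assumes "cross2 u v \<noteq> 0" "\<alpha> *\<^sub>R u + \<beta> *\<^sub>R v = \<gamma> *\<^sub>R u + \<delta> *\<^sub>R v"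
  shows "\<alpha> = \<gamma>" "\<beta> = \<delta>"
proof -
  have "\<alpha> * u $ 1 + \<beta> * v $ 1 = \<gamma> * u $ 1 + \<delta> * v $ 1"
       "\<alpha> * u $ 2 + \<beta> * v $ 2 = \<gamma> * u $ 2 + \<delta> * v $ 2"
    using arg_cong[OF assms(2), of "\<lambda>x. x $ 1"] arg_cong[OF assms(2), of "\<lambda>x. x $ 2"] by simp_all
  then have "(\<alpha> - \<gamma>) * cross2 u v = 0" "(\<beta> - \<delta>) * cross2 u v = 0"
    unfolding cross2_def by algebra+
  with assms(1) show "\<alpha> = \<gamma>" "\<beta> = \<delta>" by auto
qed

text \<open>By Lagrange's identity \<open>cross2_power2\<close>, a vanishing determinant is the
  equality case of Cauchy-Schwarz.\<close>

lemma cross2_nonzero_if_not_collinear: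
  assumes "\<not> collinear {A, B, C}"
  shows "cross2 (B - A) (C - A) \<noteq> 0"
proof
  assume "cross2 (B - A) (C - A) = 0"
  then have "((B - A) \<bullet> (C - A))\<^sup>2 = (norm (B - A) * norm (C - A))\<^sup>2"
    using cross2_power2[of "B - A" "C - A"] by (simp add: power_mult_distrib)
  then have "\<bar>(B - A) \<bullet> (C - A)\<bar> = norm (B - A) * norm (C - A)"
    by (simp only: power2_eq_iff) (auto simp: abs_mult)
  then have "collinear {0, B - A, C - A}"
    by (simp add: norm_cauchy_schwarz_equal)
  then have "collinear {B, A, C}"
    by (simp add: collinear_3)
  with assms show False by (simp add: insert_commute)
qed

section \<open>Points of contact and tangent lengths\<close>

text \<open>Both vectors from \<open>V\<close> point the same way. This turns the position of a
  contact point into the correct signs for tangent lengths.\<close>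

lemma norm_mult_if_in_closed_segment:
  fixes V P T :: "'a :: real_inner"
  assumes "P \<in> closed_segment V T"
  shows "norm (T - V) = norm (P - V) + norm (T - P)"
    and "(T - V) \<bullet> (P - V) = norm (T - V) * norm (P - V)"
proof -
  obtain t where t: "0 \<le> t" "t \<le> 1" "P = (1 - t) *\<^sub>R V + t *\<^sub>R T"
    using assms by (auto simp: closed_segment_def)
  have 1: "P - V = t *\<^sub>R (T - V)" "T - P = (1 - t) *\<^sub>R (T - V)"
    using t(3) by (simp_all add: algebra_simps)
  show "norm (T - V) = norm (P - V) + norm (T - P)"
    unfolding 1 norm_scaleR using t(1,2) by (simp add: left_diff_distrib)
  show "(T - V) \<bullet> (P - V) = norm (T - V) * norm (P - V)"
    unfolding 1 using t(1,2) by (simp add: dot_square_norm power2_eq_square)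
qed

lemma power2_norm_scaleR_diff:
  fixes u v :: "'a :: real_inner"
  shows "(norm (\<alpha> *\<^sub>R u - \<beta> *\<^sub>R v))\<^sup>2
    = \<alpha>\<^sup>2 * (norm u)\<^sup>2 - 2 * \<alpha> * \<beta> * (u \<bullet> v) + \<beta>\<^sup>2 * (norm v)\<^sup>2"
  unfolding power2_norm_eq_inner
  by (simp add: inner_diff_left inner_diff_right inner_commute[of v u] power2_eq_square algebra_simps)

text \<open>Uniqueness of the common point forces \<open>T\<close> to be the foot of the
  perpendicular from \<open>J\<close>; the rest is Pythagoras. Comparing two lines through one
  vertex then gives equal tangent lengths.\<close>

lemma tangent_atD:
  assumes "tangent_at J r P Q T" "P \<noteq> Q"
  shows "(J - P) \<bullet> (Q - P) = (T - P) \<bullet> (Q - P)"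
    and "(norm (J - P))\<^sup>2 = r\<^sup>2 + (norm (T - P))\<^sup>2"
    and "(norm (J - Q))\<^sup>2 = r\<^sup>2 + (norm (T - Q))\<^sup>2"
proof -
  have "sphere J r \<inter> affine hull {P, Q} = {T}"
    using assms(1) unfolding tangent_at_def by (rule conjunct2)
  then have T: "T \<in> sphere J r" "T \<in> affine hull {P, Q}"
    and uniq: "\<And>X. X \<in> sphere J r \<Longrightarrow> X \<in> affine hull {P, Q} \<Longrightarrow> X = T"
    by blast+
  obtain v where v: "T = P + v *\<^sub>R (Q - P)"
    using T(2) by (auto simp: affine_hull_2_alt)
  define e where "e = Q - P"
  define m where "m = (J - T) \<bullet> e / (e \<bullet> e)"
  have e: "e \<bullet> e \<noteq> 0" using assms(2) by (simp add: e_def)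
  \<comment> \<open>the reflection of \<open>T\<close> in the foot of the perpendicular from \<open>J\<close>\<close>
  define T' where "T' = T + (2 * m) *\<^sub>R e"
  have "T' = P + (v + 2 * m) *\<^sub>R (Q - P)"
    by (simp add: T'_def v e_def algebra_simps)
  then have "T' \<in> affine hull {P, Q}" by (auto simp: affine_hull_2_alt)
  moreover have "(norm (J - T'))\<^sup>2 = (norm (J - T))\<^sup>2"
  proof -
    have J: "J - T' = (J - T) - (2 * m) *\<^sub>R e" by (simp add: T'_def)
    have "(norm (J - T'))\<^sup>2 = (norm (J - T))\<^sup>2 - 4 * m * ((J - T) \<bullet> e) + 4 * m * (m * (e \<bullet> e))"
      unfolding J using power2_norm_scaleR_diff[of 1 "J - T" "2 * m" e]
      by (simp add: dot_square_norm power_mult_distrib power2_eq_square[of m])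
    also have "m * (e \<bullet> e) = (J - T) \<bullet> e" using e by (simp add: m_def)
    finally show ?thesis by simp
  qed
  then have "T' \<in> sphere J r" using T(1) by (simp add: dist_norm)
  ultimately have "T' = T" using uniq by blast
  then have perp: "(J - T) \<bullet> (Q - P) = 0"
    using e by (auto simp: T'_def m_def e_def)
  then show "(J - P) \<bullet> (Q - P) = (T - P) \<bullet> (Q - P)"
    by (simp add: inner_diff_left)
  have nJT: "norm (J - T) = r" using T(1) by (simp add: dist_norm)
  have pythagoras: "(norm (J - X))\<^sup>2 = r\<^sup>2 + (norm (T - X))\<^sup>2" if "T - X = k *\<^sub>R (Q - P)" for X k
  proof -
    have "(J - T) \<bullet> (T - X) = 0" using perp that by simp
    then have "(norm ((J - T) + (T - X)))\<^sup>2 = (norm (J - T))\<^sup>2 + (norm (T - X))\<^sup>2"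
      by (intro norm_add_Pythagorean) (simp add: orthogonal_def)
    then show ?thesis using nJT by simp
  qed
  show "(norm (J - P))\<^sup>2 = r\<^sup>2 + (norm (T - P))\<^sup>2"
    by (rule pythagoras[of _ v]) (simp add: v)
  show "(norm (J - Q))\<^sup>2 = r\<^sup>2 + (norm (T - Q))\<^sup>2"
    by (rule pythagoras[of _ "v - 1"]) (simp add: v algebra_simps)
qed

section \<open>Exradius from side lengths and area\<close>

lemma inner_eq_norms:
  fixes u v :: "'a :: real_inner"
  shows "u \<bullet> v = ((norm u)\<^sup>2 + (norm v)\<^sup>2 - (norm (v - u))\<^sup>2) / 2"
  by (simp add: power2_norm_eq_inner inner_diff_left inner_diff_right inner_commute)

text \<open>The tangent length \<open>s\<close> from \<open>V\<close> fixes the inner products of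
  \<open>J - V\<close> with both edges. Computing the length of \<open>J - V\<close> from these and
  equating its square with \<open>r^2 + s^2\<close> determines \<open>r\<close>.\<close>

lemma exradius_mult:
  assumes "is_exradius r V P Q" and nz: "cross2 (P - V) (Q - V) \<noteq> 0"
  shows "r > 0"
    and "r * (norm (P - V) + norm (Q - V) - norm (Q - P)) = \<bar>cross2 (P - V) (Q - V)\<bar>"
proof -
  have ne: "V \<noteq> P" "V \<noteq> Q" "P \<noteq> Q" using nz by (auto simp: cross2_def)
  from assms(1) obtain J T1 T2 T3 where
    T1: "T1 \<in> closed_segment P Q" "tangent_at J r P Q T1" and
    T2: "P \<in> closed_segment V T2" "tangent_at J r V P T2" and
    T3: "Q \<in> closed_segment V T3" "tangent_at J r V Q T3"
    unfolding is_exradius_def is_excircle_def by blast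
  show r: "r > 0" using T1(2) by (simp add: tangent_at_def)
  define p q d s K where "p = norm (P - V)" and "q = norm (Q - V)" and "d = norm (Q - P)"
    and "s = norm (T2 - V)" and "K = \<bar>cross2 (P - V) (Q - V)\<bar>"
  note t1 = tangent_atD[OF T1(2) ne(3)] and t2 = tangent_atD[OF T2(2) ne(1)]
    and t3 = tangent_atD[OF T3(2) ne(2)]
  note s1 = norm_mult_if_in_closed_segment[OF T1(1)]
    and s2 = norm_mult_if_in_closed_segment[OF T2(1)]
    and s3 = norm_mult_if_in_closed_segment[OF T3(1)]
  have "norm (T3 - V) = s" using t2(2) t3(2) by (simp add: s_def)
  moreover have "norm (T1 - P) = norm (T2 - P)" using t1(2) t2(3) by simp
  moreover have "norm (T1 - Q) = norm (T3 - Q)" using t1(3) t3(3) by simp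
  \<comment> \<open>The two equal tangents from \<open>V\<close> together make up the perimeter, so
    \<open>s\<close> is the semiperimeter.\<close>
  ultimately have s: "2 * s = p + q + d"
    using s1(1) s2(1) s3(1) by (simp add: p_def q_def d_def s_def norm_minus_commute)
  have wu: "(J - V) \<bullet> (P - V) = s * p" using t2(1) s2(2) by (simp add: s_def p_def)
  have wv: "(J - V) \<bullet> (Q - V) = s * q"
    using t3(1) s3(2) \<open>norm (T3 - V) = s\<close> by (simp add: q_def)
  have uv: "(P - V) \<bullet> (Q - V) = (p\<^sup>2 + q\<^sup>2 - d\<^sup>2) / 2"
    using inner_eq_norms[of "P - V" "Q - V"] by (simp add: p_def q_def d_def)
  \<comment> \<open>Heron's formula; \<open>K\<close> is twice the area.\<close>
  have K2: "4 * K\<^sup>2 = 4 * p\<^sup>2 * q\<^sup>2 - (p\<^sup>2 + q\<^sup>2 - d\<^sup>2)\<^sup>2"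
    using cross2_power2[of "P - V" "Q - V"] unfolding uv
    by (simp add: K_def p_def q_def power_divide)
  have "K\<^sup>2 * (r\<^sup>2 + s\<^sup>2) = (norm ((s * p) *\<^sub>R (Q - V) - (s * q) *\<^sub>R (P - V)))\<^sup>2"
    using cross2_power2_norm[of "P - V" "Q - V" "J - V"] t2(2)
    by (simp add: K_def wu wv s_def)
  also have "\<dots> = (s * p)\<^sup>2 * q\<^sup>2 - 2 * (s * p) * (s * q) * ((P - V) \<bullet> (Q - V)) + (s * q)\<^sup>2 * p\<^sup>2"
    unfolding power2_norm_scaleR_diff p_def q_def by (simp add: inner_commute)
  finally have K2r: "K\<^sup>2 * (r\<^sup>2 + s\<^sup>2) = s\<^sup>2 * p * q * (d\<^sup>2 - (p - q)\<^sup>2)"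
    unfolding uv by (simp add: field_simps power2_eq_square)
  have K: "K > 0" using nz by (simp add: K_def)
  have tri: "d \<le> p + q"
    using norm_triangle_ineq4[of "Q - V" "P - V"] by (simp add: p_def q_def d_def)
  \<comment> \<open>The right side of \<open>K2\<close> factors as
    \<open>((p + q)^2 - d^2) * (d^2 - (p - q)^2)\<close>, whose first factor is
    \<open>2 * s * (p + q - d)\<close>. The extra \<open>4 * K^2\<close> avoids division.\<close>
  have "4 * K\<^sup>2 * (r * (p + q - d))\<^sup>2 = 4 * K\<^sup>2 * K\<^sup>2"
    using K2 K2r s by algebra
  then have "(r * (p + q - d))\<^sup>2 = K\<^sup>2" using K by simp
  moreover have "r * (p + q - d) \<ge> 0" using r tri by simp
  ultimately have "r * (p + q - d) = K"
    using K by (simp add: power2_eq_iff_nonneg)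
  then show "r * (norm (P - V) + norm (Q - V) - norm (Q - P)) = \<bar>cross2 (P - V) (Q - V)\<bar>"
    by (simp add: p_def q_def d_def K_def)
qed

section \<open>Position of the incenter\<close>

text \<open>These are the barycentric coordinates \<open>a : b : c\<close> with origin moved to
  \<open>A\<close>. Both sides have the same inner products with two independent edges, since the
  tangent length from \<open>A\<close> is \<open>(b + c - a) / 2\<close>.\<close>

lemma incenter_barycentric:
  fixes A B C I :: "real ^ 2"
  defines "a \<equiv> norm (C - B)" and "b \<equiv> norm (A - C)" and "c \<equiv> norm (B - A)"
  assumes nz: "cross2 (B - A) (C - A) \<noteq> 0" and "is_incenter I A B C"
  shows "(a + b + c) *\<^sub>R (I - A) = b *\<^sub>R (B - A) + c *\<^sub>R (C - A)"
proof -
  have ne: "A \<noteq> B" "B \<noteq> C" "C \<noteq> A" using nz by (auto simp: cross2_def)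
  from assms(5) obtain r T1 T2 T3 where
    T1: "T1 \<in> closed_segment B C" "tangent_at I r B C T1" and
    T2: "T2 \<in> closed_segment C A" "tangent_at I r C A T2" and
    T3: "T3 \<in> closed_segment A B" "tangent_at I r A B T3"
    unfolding is_incenter_def is_incircle_def by blast
  have T2': "T2 \<in> closed_segment A C" "tangent_at I r A C T2"
    using T2 by (simp_all add: closed_segment_commute tangent_at_def insert_commute)
  note t1 = tangent_atD[OF T1(2) ne(2)] and t2 = tangent_atD[OF T2'(2) ne(3)[symmetric]]
    and t3 = tangent_atD[OF T3(2) ne(1)]
  note s1 = norm_mult_if_in_closed_segment[OF T1(1)]
    and s2 = norm_mult_if_in_closed_segment[OF T2'(1)]
    and s3 = norm_mult_if_in_closed_segment[OF T3(1)]
  define k where "k = norm (T3 - A)"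
  have k2: "norm (T2 - A) = k" using t2(2) t3(2) by (simp add: k_def)
  moreover have "norm (T1 - B) = norm (T3 - B)" using t1(2) t3(3) by simp
  moreover have "norm (T1 - C) = norm (T2 - C)" using t1(3) t2(3) by simp
  ultimately have k: "2 * k = b + c - a"
    using s1(1) s2(1) s3(1) by (simp add: a_def b_def c_def k_def norm_minus_commute)
  have uv: "(B - A) \<bullet> (C - A) = (c\<^sup>2 + b\<^sup>2 - a\<^sup>2) / 2"
    using inner_eq_norms[of "B - A" "C - A"] by (simp add: a_def b_def c_def norm_minus_commute)
  have uu: "(B - A) \<bullet> (B - A) = c\<^sup>2" and vv: "(C - A) \<bullet> (C - A) = b\<^sup>2"
    by (simp_all add: power2_norm_eq_inner b_def c_def norm_minus_commute[of A])
  have Iu: "(I - A) \<bullet> (B - A) = k * c"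
    using t3(1) s3(2) by (simp add: k_def c_def inner_commute mult.commute)
  have Iv: "(I - A) \<bullet> (C - A) = k * b"
    using t2(1) s2(2) unfolding k2 by (simp add: b_def norm_minus_commute inner_commute)
  show ?thesis
  proof (rule cross2_zero_eqI[OF nz])
    show "((a + b + c) *\<^sub>R (I - A)) \<bullet> (B - A) = (b *\<^sub>R (B - A) + c *\<^sub>R (C - A)) \<bullet> (B - A)"
      unfolding inner_add_left inner_scaleR_left Iu uu inner_commute[of "C - A" "B - A"] uv
      using k by algebra
    show "((a + b + c) *\<^sub>R (I - A)) \<bullet> (C - A) = (b *\<^sub>R (B - A) + c *\<^sub>R (C - A)) \<bullet> (C - A)"
      unfolding inner_add_left inner_scaleR_left Iv vv uv
      using k by algebra
  qed
qed

text \<open>Squaring the norm of the barycentric identity produces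
  \<open>b * c * ((b + c)^2 - a^2)\<close>, from which one factor \<open>a + b + c\<close>
  cancels.\<close>

lemma incenter_dist:
  fixes A B C I :: "real ^ 2"
  defines "a \<equiv> norm (C - B)" and "b \<equiv> norm (A - C)" and "c \<equiv> norm (B - A)"
  assumes nz: "cross2 (B - A) (C - A) \<noteq> 0" and "is_incenter I A B C"
  shows "(a + b + c) * (norm (I - A))\<^sup>2 = b * c * (b + c - a)"
proof -
  have uv: "(B - A) \<bullet> (C - A) = (c\<^sup>2 + b\<^sup>2 - a\<^sup>2) / 2"
    using inner_eq_norms[of "B - A" "C - A"] by (simp add: a_def b_def c_def norm_minus_commute)
  have uu: "(B - A) \<bullet> (B - A) = c\<^sup>2" and vv: "(C - A) \<bullet> (C - A) = b\<^sup>2"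
    by (simp_all add: power2_norm_eq_inner b_def c_def norm_minus_commute[of A])
  have "A \<noteq> B" using nz by (auto simp: cross2_def)
  then have pos: "a + b + c > 0"
    by (simp add: a_def b_def c_def add_nonneg_pos)
  have "(a + b + c)\<^sup>2 * (norm (I - A))\<^sup>2 = (norm ((a + b + c) *\<^sub>R (I - A)))\<^sup>2"
    by (simp add: power_mult_distrib)
  also have "\<dots> = (norm (b *\<^sub>R (B - A) + c *\<^sub>R (C - A)))\<^sup>2"
    using incenter_barycentric[OF assms(4,5)] by (simp add: a_def b_def c_def)
  also have "\<dots> = b * b * c\<^sup>2 + 2 * b * c * ((c\<^sup>2 + b\<^sup>2 - a\<^sup>2) / 2) + c * c * b\<^sup>2"
    unfolding power2_norm_eq_inner inner_add_left inner_add_right inner_scaleR_left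
      inner_scaleR_right inner_commute[of "C - A" "B - A"] uv uu vv
    by (simp add: field_simps power2_eq_square)
  also have "\<dots> = (a + b + c) * (b * c * (b + c - a))" by algebra
  finally show ?thesis using pos by (simp add: power2_eq_square)
qed

section \<open>The two exradii along one cevian\<close>

text \<open>Stated for the cevian from \<open>A\<close>; cyclic relabelling yields the other two
  pairs. The factor \<open>(a + b + c) / K\<close> is the reciprocal of the inradius.\<close>

lemma exradii_at_cevian:
  fixes A B C I D :: "real ^ 2"
  defines "a \<equiv> norm (C - B)" and "b \<equiv> norm (A - C)" and "c \<equiv> norm (B - A)"
    and "K \<equiv> \<bar>cross2 (B - A) (C - A)\<bar>"
  assumes nz: "cross2 (B - A) (C - A) \<noteq> 0" and I: "is_incenter I A B C"
    and D: "is_cevian A B C I D"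
    and r1: "is_exradius r1 I B D" and r2: "is_exradius r2 I D C"
  shows "1 / r1 = (a + b + c) / K * (((b + c) * norm (I - B) + a * norm (I - A)) / (a * c) - 1)"
    and "1 / r2 = (a + b + c) / K * (((b + c) * norm (I - C) + a * norm (I - A)) / (a * b) - 1)"
proof -
  have "A \<noteq> B" "B \<noteq> C" "C \<noteq> A" using nz by (auto simp: cross2_def)
  then have pos: "a > 0" "b > 0" "c > 0" by (simp_all add: a_def b_def c_def)
  have K: "K > 0" using nz by (simp add: K_def)
  define S where "S = a + b + c"
  have S: "S > 0" using pos by (simp add: S_def)
  have bary: "S *\<^sub>R (I - A) = b *\<^sub>R (B - A) + c *\<^sub>R (C - A)"
    using incenter_barycentric[OF nz I] by (simp add: a_def b_def c_def S_def)
  from D obtain t where t: "0 \<le> t" "t \<le> 1" "D = (1 - t) *\<^sub>R B + t *\<^sub>R C"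
    unfolding is_cevian_def closed_segment_def by auto
  from D obtain s where s: "0 \<le> s" "s \<le> 1" "I = (1 - s) *\<^sub>R A + s *\<^sub>R D"
    unfolding is_cevian_def closed_segment_def by auto
  \<comment> \<open>Comparing coefficients with \<open>bary\<close> gives
    \<open>S * s * (1 - t) = b\<close> and \<open>S * s * t = c\<close>; their sum yields
    \<open>s\<close>, and then \<open>t\<close> is the bisector ratio.\<close>
  have "(S * (s * (1 - t))) *\<^sub>R (B - A) + (S * (s * t)) *\<^sub>R (C - A) = S *\<^sub>R (I - A)"
    unfolding s(3) t(3) by (simp add: algebra_simps)
  note coeffs = cross2_scaleR_eq[OF nz this[unfolded bary]]
  have sS: "s * S = b + c" using coeffs by (simp add: algebra_simps)
  have st: "t * (b + c) = c" using coeffs(2) sS by (metis mult.assoc mult.commute)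
  have teq: "t = c / (b + c)" using st pos by (simp add: field_simps)
  have DB: "D - B = t *\<^sub>R (C - B)" and CD: "C - D = (1 - t) *\<^sub>R (C - B)"
    unfolding t(3) by (simp_all add: algebra_simps)
  have BDl: "norm (D - B) = a * c / (b + c)"
    unfolding DB using pos by (simp add: teq a_def)
  have t1: "1 - t = b / (b + c)" using pos by (simp add: teq field_simps)
  have CDl: "norm (C - D) = a * b / (b + c)"
    unfolding CD t1 using pos by (simp add: a_def)
  have "(b + c) *\<^sub>R (D - I) = a *\<^sub>R (I - A)"
  proof -
    have "I - A = s *\<^sub>R (D - A)" "D - I = (1 - s) *\<^sub>R (D - A)"
      unfolding s(3) by (simp_all add: algebra_simps)
    moreover have "(b + c) * (1 - s) = a * s" using sS by (simp add: S_def algebra_simps)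
    ultimately show ?thesis by simp
  qed
  from arg_cong[OF this, of norm] have "(b + c) * norm (D - I) = a * norm (I - A)"
    using pos by simp
  then have DIl: "norm (D - I) = a * norm (I - A) / (b + c)"
    using pos by (simp add: eq_divide_eq mult.commute)
  \<comment> \<open>Triangle \<open>IBC\<close> has the share \<open>a / S\<close> of the area of
    \<open>ABC\<close>; \<open>D\<close> then splits it in the ratio of \<open>BD\<close> to
    \<open>DC\<close>.\<close>
  have SI: "S * cross2 (B - I) (C - B) = a * cross2 (B - A) (C - A)"
  proof -
    have "S * (I - A) $ i = b * (B - A) $ i + c * (C - A) $ i" for i
      using arg_cong[OF bary, of "\<lambda>x. x $ i"] by simp
    from this[of 1] this[of 2] show ?thesis
      unfolding cross2_def S_def vector_minus_component by algebra
  qed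
  have h: "\<bar>cross2 (B - I) (C - B)\<bar> = a * K / S"
  proof -
    have "S * \<bar>cross2 (B - I) (C - B)\<bar> = a * K"
      using arg_cong[OF SI, of abs] S pos by (simp add: abs_mult K_def)
    then show ?thesis using S by (simp add: field_simps)
  qed
  have "cross2 (B - I) (D - I) = t * cross2 (B - I) (C - B)"
    unfolding t(3) cross2_def by (simp add: algebra_simps)
  then have X1: "\<bar>cross2 (B - I) (D - I)\<bar> = K / S * (a * c / (b + c))"
    using h pos by (simp add: abs_mult teq)
  have "cross2 (D - I) (C - I) = (1 - t) * cross2 (B - I) (C - B)"
    unfolding t(3) cross2_def by (simp add: algebra_simps)
  then have X2: "\<bar>cross2 (D - I) (C - I)\<bar> = K / S * (a * b / (b + c))"
    using h pos by (simp add: abs_mult t1)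
  have "\<bar>cross2 (B - I) (D - I)\<bar> > 0" unfolding X1 using pos K S by simp
  then have nz1: "cross2 (B - I) (D - I) \<noteq> 0" by simp
  have "\<bar>cross2 (D - I) (C - I)\<bar> > 0" unfolding X2 using pos K S by simp
  then have nz2: "cross2 (D - I) (C - I) \<noteq> 0" by simp
  \<comment> \<open>One computation for both triangles: \<open>e = c\<close> for the one on
    \<open>BD\<close>, \<open>e = b\<close> for the one on \<open>DC\<close>.\<close>
  have solve: "1 / r = S / K * (((b + c) * y + a * x) / (a * e) - 1)"
    if "r > 0" "e > 0"
      "r * (y + a * x / (b + c) - a * e / (b + c)) = K / S * (a * e / (b + c))" for r x y e
  proof -
    have bc: "b + c > 0" using pos by simp
    have "1 / r = (y + a * x / (b + c) - a * e / (b + c)) / (K / S * (a * e / (b + c)))"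
      unfolding that(3)[symmetric] using that pos K S bc
      by (metis (no_types, lifting) divide_divide_eq_right divide_self_if mult.commute mult_eq_0_iff
          nonzero_divide_mult_cancel_left nonzero_divide_mult_cancel_right divide_pos_pos mult_pos_pos less_irrefl)
    also have "\<dots> = S / K * (((b + c) * y + a * x) / (a * e) - 1)"
      using that(2) pos K S bc by (simp add: divide_simps)
    finally show ?thesis .
  qed
  show "1 / r1 = (a + b + c) / K * (((b + c) * norm (I - B) + a * norm (I - A)) / (a * c) - 1)"
    using solve[OF exradius_mult(1)[OF r1 nz1] pos(3)] exradius_mult(2)[OF r1 nz1]
    unfolding X1 BDl DIl S_def by (simp add: norm_minus_commute)
  show "1 / r2 = (a + b + c) / K * (((b + c) * norm (I - C) + a * norm (I - A)) / (a * b) - 1)"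
    using solve[OF exradius_mult(1)[OF r2 nz2] pos(2)] exradius_mult(2)[OF r2 nz2]
    unfolding X2 CDl DIl S_def by (simp add: norm_minus_commute add.commute)
qed

section \<open>The angle condition and the final identity\<close>

lemma angle_60_cosine_law:
  assumes "A \<noteq> B" "C \<noteq> B" "angle A B C = pi / 3"
  shows "(norm (A - C))\<^sup>2 = (norm (C - B))\<^sup>2 + (norm (B - A))\<^sup>2 - norm (C - B) * norm (B - A)"
proof -
  define q where "q = ((A - B) \<bullet> (C - B)) / (norm (A - B) * norm (C - B))"
  \<comment> \<open>Cauchy-Schwarz puts \<open>q\<close> in the range where \<open>cos\<close>
    inverts \<open>arccos\<close>.\<close>
  have "\<bar>q\<bar> \<le> 1"
    using Cauchy_Schwarz_ineq2[of "A - B" "C - B"] assms(1,2)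
    by (simp add: q_def abs_mult divide_le_eq_1)
  then have "q = cos (angle A B C)"
    by (simp add: angle_def q_def[symmetric] cos_arccos_abs)
  then have "(A - B) \<bullet> (C - B) = norm (A - B) * norm (C - B) / 2"
    using assms by (simp add: q_def cos_60 field_simps)
  then show ?thesis
    using inner_eq_norms[of "A - B" "C - B"] by (simp add: norm_minus_commute algebra_simps)
qed

theorem theorem8p2:
  fixes A B C I D E F :: "real ^ 2" and r1 r2 r3 r4 r5 r6 :: real
  assumes triangle: "\<not> collinear {A, B, C}"
    and incenter: "is_incenter I A B C"
    and angle_B: "angle A B C = pi / 3"
    and AD: "is_cevian A B C I D"
    and BE: "is_cevian B C A I E"
    and CF: "is_cevian C A B I F"
    and r1: "is_exradius r1 I B D"
    and r2: "is_exradius r2 I D C"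
    and r3: "is_exradius r3 I C E"
    and r4: "is_exradius r4 I E A"
    and r5: "is_exradius r5 I A F"
    and r6: "is_exradius r6 I F B"
  shows "1 / r1 + 1 / r4 + 1 / r5 = 1 / r2 + 1 / r3 + 1 / r6"
proof -
  have nzA: "cross2 (B - A) (C - A) \<noteq> 0"
    using triangle by (rule cross2_nonzero_if_not_collinear)
  \<comment> \<open>Cyclic invariance of the determinant lets a single \<open>\<sigma>\<close> serve
    all six radii.\<close>
  have crB: "cross2 (C - B) (A - B) = cross2 (B - A) (C - A)"
    and crC: "cross2 (A - C) (B - C) = cross2 (B - A) (C - A)"
    by (simp_all add: cross2_def algebra_simps)
  have nzB: "cross2 (C - B) (A - B) \<noteq> 0" and nzC: "cross2 (A - C) (B - C) \<noteq> 0"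
    using nzA crB crC by auto
  have IB: "is_incenter I B C A" and IC: "is_incenter I C A B"
    using incenter by (auto simp: is_incenter_def is_incircle_def)
  have ne: "A \<noteq> B" "B \<noteq> C" "C \<noteq> A" using nzA by (auto simp: cross2_def)
  define a b c where "a = norm (C - B)" and "b = norm (A - C)" and "c = norm (B - A)"
  define x y z where "x = norm (I - A)" and "y = norm (I - B)" and "z = norm (I - C)"
  note defs = a_def[symmetric] b_def[symmetric] c_def[symmetric]
    x_def[symmetric] y_def[symmetric] z_def[symmetric]
  define \<sigma> where "\<sigma> = (a + b + c) / \<bar>cross2 (B - A) (C - A)\<bar>"
  have pos: "a > 0" "b > 0" "c > 0" using ne by (simp_all add: a_def b_def c_def)
  have cos_law: "b\<^sup>2 = a\<^sup>2 + c\<^sup>2 - a * c"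
    using angle_60_cosine_law[OF ne(1) ne(2)[symmetric] angle_B] unfolding defs .
  have x2: "(a + b + c) * x\<^sup>2 = b * c * (b + c - a)"
    using incenter_dist[OF nzA incenter] unfolding defs .
  have z2: "(a + b + c) * z\<^sup>2 = a * b * (a + b - c)"
    using incenter_dist[OF nzC IC] unfolding defs by (simp add: add_ac)
  have e1: "(a + b) * (b + c - a) = c * (b + c)" and e2: "(b + c) * (a + b - c) = a * (a + b)"
    using cos_law by algebra+
  \<comment> \<open>Both sides reduce to \<open>a^2 * b * c^2 * (a + b) * (b + c)\<close>.\<close>
  have "(a + b + c) * (a * (a + b) * x)\<^sup>2 = (a + b + c) * (c * (b + c) * z)\<^sup>2"
    using x2 z2 e1 e2 by algebra
  then have "(a * (a + b) * x)\<^sup>2 = (c * (b + c) * z)\<^sup>2" using pos by simp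
  moreover have "a * (a + b) * x \<ge> 0" "c * (b + c) * z \<ge> 0"
    using pos by (simp_all add: x_def z_def)
  ultimately have key: "a * (a + b) * x = c * (b + c) * z"
    by (simp add: power2_eq_iff_nonneg)
  have R1: "1 / r1 = \<sigma> * (((b + c) * y + a * x) / (a * c) - 1)"
    and R2: "1 / r2 = \<sigma> * (((b + c) * z + a * x) / (a * b) - 1)"
    using exradii_at_cevian[OF nzA incenter AD r1 r2] unfolding defs \<sigma>_def .
  have R3: "1 / r3 = \<sigma> * (((c + a) * z + b * y) / (b * a) - 1)"
    and R4: "1 / r4 = \<sigma> * (((c + a) * x + b * y) / (b * c) - 1)"
    using exradii_at_cevian[OF nzB IB BE r3 r4] unfolding defs \<sigma>_def crB by (simp_all add: add_ac)
  have R5: "1 / r5 = \<sigma> * (((a + b) * x + c * z) / (c * b) - 1)"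
    and R6: "1 / r6 = \<sigma> * (((a + b) * y + c * z) / (c * a) - 1)"
    using exradii_at_cevian[OF nzC IC CF r5 r6] unfolding defs \<sigma>_def crC by (simp_all add: add_ac)
  have "((b + c) * y + a * x) / (a * c) + ((c + a) * x + b * y) / (b * c)
        + ((a + b) * x + c * z) / (c * b)
      - (((b + c) * z + a * x) / (a * b) + ((c + a) * z + b * y) / (b * a)
        + ((a + b) * y + c * z) / (c * a))
      = 2 * (a * (a + b) * x - c * (b + c) * z) / (a * b * c)"
    using pos by (simp add: divide_simps) algebra
  also have "\<dots> = 0" using key by simp
  finally have sum: "((b + c) * y + a * x) / (a * c) + ((c + a) * x + b * y) / (b * c)
        + ((a + b) * x + c * z) / (c * b)
      = ((b + c) * z + a * x) / (a * b) + ((c + a) * z + b * y) / (b * a)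
        + ((a + b) * y + c * z) / (c * a)" by simp
  show ?thesis
    \<comment> \<open>Each side collects three terms \<open>-1\<close>, hence
      \<open>w - 3\<close>.\<close>
    unfolding R1 R2 R3 R4 R5 R6 using arg_cong[OF sum, of "\<lambda>w. \<sigma> * (w - 3)"]
    by (simp add: algebra_simps)
qed

end
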